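(* Let $k\ge 3$ be an integer and let $n=\frac{k(k+1)}{2}$. Then there exists an $n$-tuple $\boldsymbol{\alpha}=(\alpha_1,\dots,\alpha_n)$ of pairwise incommensurable real numbers with $$\mathfrak{k}(\boldsymbol{\alpha})=k.$$
   Context: For a real number $\alpha$ and real $t\ge 1$ put $\psi_\alpha(t)=\min_{q\in\mathbb{Z}_+,\ q\le t}\|q\alpha\|$, where $\mathbb{Z}_+$ is the set of positive integers and $\|x\|=\min_{a\in\mathbb{Z}}|x-a|$ (the irrationality measure function of $\alpha$). Two real numbers $\alpha,\beta$ are called incommensurable if $\psi_\alpha(t)\ne\psi_\beta(t)$ for all sufficiently large $t$. Let $\boldsymbol{\alpha}=(\alpha_1,\dots,\alpha_n)$ be an $n$-tuple of pairwise incommensurable real numbers (i.e. $\alpha_i,\alpha_j$ are incommensurable for all $i\ne j$). For every sufficiently large $t$ the values $\psi_{\alpha_1}(t),\dots,\psi_{\alpha_n}(t)$ are pairwise distinct, so there is a unique permutation $\boldsymbol{\sigma}(t):\{1,2,\dots,n\}\mapsto\{\sigma_1,\sigma_2,\dots,\sigma_n\}$ with $$\psi_{\alpha_{\sigma_1}}(t)>\psi_{\alpha_{\sigma_2}}(t)>\dots>\psi_{\alpha_{\sigma_n}}(t).$$ The $\mathfrak{k}$-index of $\boldsymbol{\alpha}$ is $$\mathfrak{k}(\boldsymbol{\alpha})=\max\{k:\ \text{there exist distinct permutations } \boldsymbol{\sigma}_1,\dots,\boldsymbol{\sigma}_k \text{ such that } \forall j\ \forall t_0>0\ \exists t>t_0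 \text{ with } \boldsymbol{\sigma}(t)=\boldsymbol{\sigma}_j\},$$ i.e. the number of permutations that occur as $\boldsymbol{\sigma}(t)$ for arbitrarily large $t$. *)

theory Defs
  imports Complex_Main "HOL-Combinatorics.Permutations"
begin

definition int_dist :: "real \<Rightarrow> real" where
  "int_dist x = (INF a::int. \<bar>x - of_int a\<bar>)"

text \<open>The infimum is attained, so it is the minimum over the integers.\<close>

lemma int_dist_eq_round: "int_dist x = \<bar>x - of_int (round x)\<bar>"
  unfolding int_dist_def
proof (rule cInf_eq_minimum)
  show "\<bar>x - of_int (round x)\<bar> \<in> range (\<lambda>a::int. \<bar>x - of_int a\<bar>)" by blast
  show "\<bar>x - of_int (round x)\<bar> \<le> y" if "y \<in> range (\<lambda>a::int. \<bar>x - of_int a\<bar>)" for y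
    using that round_diff_minimal[of x] by auto
qed

text \<open>Meaningful for \<open>t \<ge> 1\<close>: then the set of admissible \<open>q\<close> is finite and nonempty.\<close>

definition irr_meas :: "real \<Rightarrow> real \<Rightarrow> real" where
  "irr_meas \<alpha> t = Min ((\<lambda>q::nat. int_dist (real q * \<alpha>)) ` {q. 1 \<le> q \<and> real q \<le> t})"

lemma irr_meas_range:
  assumes "t \<ge> 1"
  shows "finite {q::nat. 1 \<le> q \<and> real q \<le> t}" "{q::nat. 1 \<le> q \<and> real q \<le> t} \<noteq> {}"
proof -
  have "{q::nat. 1 \<le> q \<and> real q \<le> t} \<subseteq> {..nat \<lfloor>t\<rfloor>}" by (auto simp: le_nat_floor)
  then show "finite {q::nat. 1 \<le> q \<and> real q \<le> t}" using finite_subset by blast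
  show "{q::nat. 1 \<le> q \<and> real q \<le> t} \<noteq> {}" using assms by (auto intro!: exI[of _ 1])
qed

definition incommensurable :: "real \<Rightarrow> real \<Rightarrow> bool" where
  "incommensurable \<alpha> \<beta> \<longleftrightarrow> (\<forall>\<^sub>F t in at_top. irr_meas \<alpha> t \<noteq> irr_meas \<beta> t)"

text \<open>An \<open>n\<close>-tuple is a function \<open>\<alpha>\<close> on indices \<open>1, \<dots>, n\<close>; its values elsewhere are irrelevant.\<close>

definition pairwise_incommensurable :: "nat \<Rightarrow> (nat \<Rightarrow> real) \<Rightarrow> bool" where
  "pairwise_incommensurable n \<alpha> \<longleftrightarrow>
     (\<forall>i\<in>{1..n}. \<forall>j\<in>{1..n}. i \<noteq> j \<longrightarrow> incommensurable (\<alpha> i) (\<alpha> j))"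

text \<open>\<open>permutes\<close> makes permutations the identity outside \<open>{1..n}\<close>, so that two permutations
  are equal as functions iff they agree on \<open>{1..n}\<close>.\<close>

definition orders_at :: "nat \<Rightarrow> (nat \<Rightarrow> real) \<Rightarrow> real \<Rightarrow> (nat \<Rightarrow> nat) \<Rightarrow> bool" where
  "orders_at n \<alpha> t \<sigma> \<longleftrightarrow> \<sigma> permutes {1..n} \<and>
     (\<forall>i\<in>{1..n}. \<forall>j\<in>{1..n}. i < j \<longrightarrow> irr_meas (\<alpha> (\<sigma> i)) t > irr_meas (\<alpha> (\<sigma> j)) t)"

definition order_perm :: "nat \<Rightarrow> (nat \<Rightarrow> real) \<Rightarrow> real \<Rightarrow> (nat \<Rightarrow> nat)" where
  "order_perm n \<alpha> t = (THE \<sigma>. orders_at n \<alpha> t \<sigma>)"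

lemma orders_at_ex1:
  assumes inj: "inj_on (\<lambda>i. irr_meas (\<alpha> i) t) {1..n}"
  shows "\<exists>!\<sigma>. orders_at n \<alpha> t \<sigma>"
proof -
  define f where "f i = irr_meas (\<alpha> i) t" for i
  define r where "r i = (if i \<in> {1..n} then Suc (card {j\<in>{1..n}. f j > f i}) else i)" for i
  have less: "r i < r j" if "i \<in> {1..n}" "j \<in> {1..n}" "f i > f j" for i j
  proof -
    have "{l\<in>{1..n}. f l > f i} \<subset> {l\<in>{1..n}. f l > f j}" using that by auto
    then have "card {l\<in>{1..n}. f l > f i} < card {l\<in>{1..n}. f l > f j}"
      by (intro psubset_card_mono) auto
    then show ?thesis using that by (simp add: r_def)
  qed
  have "inj_on r {1..n}"
  proof (rule inj_onI)
    fix i j assume ij: "i \<in> {1..n}" "j \<in> {1..n}" "r i = r j"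
    then have "f i = f j" using less[of i j] less[of j i] by (cases "f i" "f j" rule: linorder_cases) auto
    then show "i = j" using inj ij unfolding f_def inj_on_def by blast
  qed
  moreover have sub: "r ` {1..n} \<subseteq> {1..n}"
  proof
    fix y assume "y \<in> r ` {1..n}"
    then obtain i where i: "i \<in> {1..n}" "y = r i" by blast
    have "{j\<in>{1..n}. f j > f i} \<subset> {1..n}" using i(1) by blast
    then have "card {j\<in>{1..n}. f j > f i} < card {1..n}" by (intro psubset_card_mono) simp_all
    then show "y \<in> {1..n}" using i by (simp add: r_def)
  qed
  ultimately have "bij_betw r {1..n} {1..n}"
    by (simp add: bij_betw_def endo_inj_surj)
  then have r: "r permutes {1..n}" by (rule bij_imp_permutes) (auto simp: r_def)
  have "orders_at n \<alpha> t (inv r)"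
    unfolding orders_at_def
  proof (intro conjI ballI impI)
    show p: "inv r permutes {1..n}" using r by (rule permutes_inv)
    fix i j assume ij: "i \<in> {1..n}" "j \<in> {1..n}" "i < j"
    let ?a = "inv r i" and ?b = "inv r j"
    have ab: "?a \<in> {1..n}" "?b \<in> {1..n}" using permutes_in_image[OF p] ij by blast+
    have rr: "r ?a = i" "r ?b = j" using permutes_inverses[OF r] by auto
    have "f ?a \<noteq> f ?b" using inj ab rr ij(3) unfolding f_def inj_on_def by (metis less_irrefl)
    moreover have "\<not> f ?a < f ?b" using less[OF ab(2,1)] rr ij by auto
    ultimately show "irr_meas (\<alpha> ?b) t < irr_meas (\<alpha> ?a) t" by (simp add: f_def)
  qed
  moreover have "\<sigma> = inv r" if "orders_at n \<alpha> t \<sigma>" for \<sigma>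
  proof -
    have p: "\<sigma> permutes {1..n}"
      and d: "\<And>i j. i \<in> {1..n} \<Longrightarrow> j \<in> {1..n} \<Longrightarrow> i < j \<Longrightarrow> f (\<sigma> i) > f (\<sigma> j)"
      using that unfolding orders_at_def f_def by auto
    have "r (\<sigma> i) = i" for i
    proof (cases "i \<in> {1..n}")
      case True
      have "{j\<in>{1..n}. f j > f (\<sigma> i)} = \<sigma> ` {1..<i}"
      proof (intro equalityI subsetI)
        fix j assume j: "j \<in> {j\<in>{1..n}. f j > f (\<sigma> i)}"
        then obtain l where l: "l \<in> {1..n}" "j = \<sigma> l" using permutes_image[OF p] by blast
        then have "l < i" using d[of i l] True j by (cases l i rule: linorder_cases) auto
        then show "j \<in> \<sigma> ` {1..<i}" using l by auto
      next
        fix j assume "j \<in> \<sigma> ` {1..<i}"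
        then obtain l where l: "l \<in> {1..<i}" "j = \<sigma> l" by blast
        then have "l \<in> {1..n}" using True by auto
        then show "j \<in> {j\<in>{1..n}. f j > f (\<sigma> i)}"
          using d[of l i] True l permutes_in_image[OF p, of l] by auto
      qed
      moreover have "card (\<sigma> ` {1..<i}) = i - 1"
        using permutes_inj_on[OF p] by (simp add: card_image)
      moreover have "\<sigma> i \<in> {1..n}" using True permutes_in_image[OF p] by blast
      ultimately show ?thesis using True by (simp add: r_def)
    next
      case False
      then show ?thesis using permutes_not_in[OF p False] unfolding r_def by (simp only: if_False)
    qed
    then have "inv r i = \<sigma> i" for i using permutes_inverses(2)[OF r, of "\<sigma> i"] by simp
    then show ?thesis by (intro ext) simp
  qed
  ultimately show ?thesis by blast
qed

definition occurs_arbitrarily_late :: "nat \<Rightarrow> (nat \<Rightarrow> real) \<Rightarrow> (nat \<Rightarrow> nat) \<Rightarrow> bool" where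
  "occurs_arbitrarily_late n \<alpha> \<sigma> \<longleftrightarrow> (\<forall>t0>0. \<exists>t>t0. order_perm n \<alpha> t = \<sigma>)"

definition k_index :: "nat \<Rightarrow> (nat \<Rightarrow> real) \<Rightarrow> nat" where
  "k_index n \<alpha> = Max {k. \<exists>\<tau> :: nat \<Rightarrow> (nat \<Rightarrow> nat). inj_on \<tau> {1..k} \<and>
     (\<forall>j\<in>{1..k}. \<tau> j permutes {1..n} \<and> occurs_arbitrarily_late n \<alpha> (\<tau> j))}"

lemma k_index_eq_card:
  "k_index n \<alpha> = card {\<sigma>. \<sigma> permutes {1..n} \<and> occurs_arbitrarily_late n \<alpha> \<sigma>}"
proof -
  let ?S = "{\<sigma>. \<sigma> permutes {1..n} \<and> occurs_arbitrarily_late n \<alpha> \<sigma>}"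
  have fin: "finite ?S" using finite_permutations[of "{1..n}"] by (rule rev_finite_subset) auto
  have "{k. \<exists>\<tau> :: nat \<Rightarrow> (nat \<Rightarrow> nat). inj_on \<tau> {1..k} \<and>
     (\<forall>j\<in>{1..k}. \<tau> j permutes {1..n} \<and> occurs_arbitrarily_late n \<alpha> (\<tau> j))} = {..card ?S}"
    (is "?K = _")
  proof (intro equalityI subsetI)
    fix k assume "k \<in> ?K"
    then obtain \<tau> where \<tau>: "inj_on \<tau> {1..k}" "\<tau> ` {1..k} \<subseteq> ?S" by auto
    then show "k \<in> {..card ?S}" using card_inj_on_le[OF \<tau> fin] by simp
  next
    fix k assume "k \<in> {..card ?S}"
    then obtain T where T: "T \<subseteq> ?S" "card T = k" "finite T"
      using obtain_subset_with_card_n[of k ?S] by auto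
    then obtain \<tau> where "bij_betw \<tau> {1..k} T" using ex_bij_betw_nat_finite_1 by blast
    then have "inj_on \<tau> {1..k}" "\<tau> ` {1..k} = T" unfolding bij_betw_def by auto
    then show "k \<in> ?K" using T by blast
  qed
  then show ?thesis unfolding k_index_def by (simp add: Max_eq_iff)
qed

end

(* Two numbers never share two consecutive convergent denominators unless their whole sequences
   of denominators agree. Take times T_0 << T_1 << ... growing so fast that the value of the
   measure function on a block [T_s, T_(s+1)) is ordered by the next denominator T_b (a smaller b
   gives a larger value) and, among numbers sharing b, by the denominator T_c after it (a larger c
   gives a larger value). This follows from T_b * z + T_a * z' = 1 for consecutive values z, z' and
   consecutive denominators T_a, T_b, with z' close to 1 / T_c.
   The Chinese remainder theorem provides times such that for each pair i <= j < k some real number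
   has the denominators T_m with m mod k in {i, j}. No two of these k(k+1)/2 numbers share two
   consecutive denominators, so the order is always strict, and it depends only on s mod k. *)

theory Submission
  imports Defs "HOL-Number_Theory.Cong"
begin

section \<open>Denominator times from the Chinese remainder theorem\<close>

text \<open>Adding a multiple of the product of all moduli changes no residue, and this product is
  at least 1, so a solution can be pushed past any bound.\<close>

lemma ex_large_cong_solution:
  fixes m u :: "'a \<Rightarrow> nat"
  assumes "finite A" and "\<And>i j. i \<in> A \<Longrightarrow> j \<in> A \<Longrightarrow> i \<noteq> j \<Longrightarrow> coprime (m i) (m j)"
    and pos: "\<And>i. i \<in> A \<Longrightarrow> 0 < m i"
  shows "\<exists>x\<ge>B. \<forall>i\<in>A. [x = u i] (mod m i)"
proof -
  obtain x where x: "\<forall>i\<in>A. [x = u i] (mod m i)"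
    using chinese_remainder_nat[of A m u] assms by blast
  have "0 < prod m A"
    using pos by (intro prod_pos) auto
  then have "B \<le> x + B * prod m A"
    by (cases "prod m A") auto
  moreover have "[x + B * prod m A = u i] (mod m i)" if "i \<in> A" for i
  proof -
    have "m i dvd B * prod m A"
      using that \<open>finite A\<close> by (simp add: dvd_prodI)
    then have "[x + B * prod m A = x + 0] (mod m i)"
      by (intro cong_add) (auto simp: cong_0_iff)
    then show ?thesis
      using x that cong_trans by fastforce
  qed
  ultimately show ?thesis
    by blast
qed

text \<open>Each congruence is the continued fraction condition on three consecutive denominators of
  one number: \<open>T_cong_twice\<close> for numbers using one residue class of indices,
  \<open>T_cong_between\<close> for those using two. The quadratic growth serves to compare
  values.\<close>

locale jump_times =
  fixes k :: nat and T :: "nat \<Rightarrow> nat"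
  assumes k_pos: "0 < k"
    and T_pos: "0 < T m"
    and T_growth: "2 * (T m)\<^sup>2 < T (Suc m)"
    and T_coprime: "l < m \<Longrightarrow> m \<le> l + k \<Longrightarrow> coprime (T l) (T m)"
    and T_cong_twice: "[T (a + 2 * k) = T a] (mod T (a + k))"
    and T_cong_between: "a < b \<Longrightarrow> b < a + k \<Longrightarrow> [T (a + k) = T a] (mod T b)"

text \<open>Strong recursion: only the last \<open>k\<close> times constrain \<open>T m\<close> by
  congruences, and these are pairwise coprime, so a suitable large value exists.\<close>

lemma ex_jump_times:
  assumes "0 < k"
  shows "\<exists>T. jump_times k T"
proof -
  \<comment> \<open>residue prescribed for \<open>T m\<close> modulo \<open>T l\<close>; the value 1 replaces missing earlier times\<close>
  define r where "r f m l = (if m = l + k then if m \<ge> 2 * k then f (m - 2 * k) else 1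
      else if m \<ge> k then f (m - k) else 1)" for f :: "nat \<Rightarrow> nat" and m l :: nat
  define P where "P f m x \<longleftrightarrow> 0 < x \<and> (\<forall>l<m. 2 * (f l)\<^sup>2 < x) \<and>
      (\<forall>l<m. m \<le> l + k \<longrightarrow> coprime (f l) x \<and> [x = r f m l] (mod f l))"
    for f :: "nat \<Rightarrow> nat" and m x :: nat
  have "\<exists>T. \<forall>m. P T m (T m)"
  proof (rule dependent_wf_choice[of less_than])
    fix f g :: "nat \<Rightarrow> nat" and m x
    assume fg: "\<And>l. (l, m) \<in> less_than \<Longrightarrow> f l = g l"
    have "r f m l = r g m l" if "l < m" for l
      using that fg \<open>0 < k\<close> by (auto simp: r_def)
    then show "P f m x = P g m x"
      using fg by (auto simp: P_def)
  next
    fix m and f :: "nat \<Rightarrow> nat"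
    assume "\<And>l. (l, m) \<in> less_than \<Longrightarrow> P f l (f l)"
    then have IH: "P f l (f l)" if "l < m" for l
      using that by auto
    have cop: "coprime (f l) (f l')" if "l < l'" "l' < m" "l' \<le> l + k" for l l'
      using IH[of l'] that by (auto simp: P_def)
    define A where "A = {l. l < m \<and> m \<le> l + k}"
    have "coprime (f i) (f j)" if "i \<in> A" "j \<in> A" "i \<noteq> j" for i j
      using that cop[of i j] cop[of j i] by (cases i j rule: linorder_cases) (auto simp: A_def coprime_commute)
    moreover have "finite A"
      by (auto simp: A_def)
    ultimately obtain x where x: "x \<ge> 1 + (\<Sum>l<m. 2 * (f l)\<^sup>2)" "\<forall>l\<in>A. [x = r f m l] (mod f l)"
      using ex_large_cong_solution[of A f "1 + (\<Sum>l<m. 2 * (f l)\<^sup>2)" "r f m"] IH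
      unfolding A_def P_def by blast
    have "2 * (f l)\<^sup>2 < x" if "l < m" for l
    proof -
      have "2 * (f l)\<^sup>2 \<le> (\<Sum>l<m. 2 * (f l)\<^sup>2)"
        using that by (intro member_le_sum) auto
      then show ?thesis
        using x by linarith
    qed
    moreover have "coprime (f l) x" if "l < m" "m \<le> l + k" for l
    proof -
      \<comment> \<open>The residue is 1 or an earlier time whose index is within \<open>k\<close>
        of \<open>l\<close>, hence coprime to the modulus; the congruence transfers this to
        \<open>x\<close>.\<close>
      have "coprime (r f m l) (f l)"
      proof (cases "m = l + k")
        case True
        then show ?thesis
          using cop[of "l - k" l] that \<open>0 < k\<close> by (auto simp: r_def mult_2)
      next
        case False
        then show ?thesis
          using cop[of "m - k" l] that by (auto simp: r_def)
      qed
      moreover have "[r f m l = x] (mod f l)"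
        using x(2) that by (auto simp: A_def cong_sym_eq)
      ultimately show ?thesis
        using cong_imp_coprime coprime_commute by blast
    qed
    ultimately show "\<exists>x. P f m x"
      using x unfolding P_def A_def by (intro exI[of _ x]) auto
  qed auto
  then obtain T where T: "\<And>m. P T m (T m)"
    by blast
  have "jump_times k T"
  proof
    fix a
    show "[T (a + 2 * k) = T a] (mod T (a + k))"
      using T[of "a + 2 * k"] \<open>0 < k\<close> unfolding P_def
      by (auto simp: r_def dest!: spec[of _ "a + k"])
    fix b assume "a < b" "b < a + k"
    then show "[T (a + k) = T a] (mod T b)"
      using T[of "a + k"] by (auto simp: P_def r_def)
  qed (use T \<open>0 < k\<close> in \<open>auto simp: P_def\<close>)
  then show ?thesis
    by blast
qed

section \<open>Real numbers with prescribed denominators\<close>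

text \<open>The errors of the two fractions have opposite signs. For \<open>0 < b < q'\<close> the
  coordinates \<open>x\<close>, \<open>y\<close> cannot have the same strict sign and
  \<open>x\<close> is nonzero, so the two contributions to the error add up and the first alone is
  at least \<open>z\<close>.\<close>

lemma det_best_approximation:
  fixes p p' q q' a b :: int and \<alpha> z z' e :: real
  assumes det: "p' * q - p * q' = d" and d: "d = 1 \<or> d = -1"
    and q: "0 < q" "0 < q'" and z: "0 \<le> z" "0 \<le> z'"
    and eqs: "q * \<alpha> - p = d * z" "q' * \<alpha> - p' = - (d * z')"
    and b: "0 < b" "b < q'"
  shows "z \<le> \<bar>b * \<alpha> - a\<bar>"
proof -
  \<comment> \<open>coordinates of \<open>(b, a)\<close> in the unimodular basis \<open>(q, p)\<close>, \<open>(q', p')\<close>\<close>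
  define x where "x = d * (b * p' - a * q')"
  define y where "y = d * (a * q - b * p)"
  have dd: "d * d = 1"
    using d by auto
  have bx: "b = x * q + y * q'"
  proof -
    have "x * q + y * q' = d * (b * (p' * q - p * q'))"
      unfolding x_def y_def by (simp add: algebra_simps)
    then show ?thesis
      using det dd by (simp add: algebra_simps)
  qed
  have ax: "a = x * p + y * p'"
  proof -
    have "x * p + y * p' = d * (a * (p' * q - p * q'))"
      unfolding x_def y_def by (simp add: algebra_simps)
    then show ?thesis
      using det dd by (simp add: algebra_simps)
  qed
  have "b * \<alpha> - a = x * (q * \<alpha> - p) + y * (q' * \<alpha> - p')"
    unfolding bx ax by (simp add: algebra_simps)
  also have "\<dots> = d * (x * z - y * z')"
    unfolding eqs by (simp add: algebra_simps)
  finally have abs_eq: "\<bar>b * \<alpha> - a\<bar> = \<bar>x * z - y * z'\<bar>"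
    using d by auto
  consider "x \<ge> 1" "y \<le> 0" | "x \<le> -1" "y \<ge> 0" | "x = 0" | "x \<ge> 1" "y \<ge> 1" | "x \<le> -1" "y \<le> -1"
    by linarith
  then show ?thesis
  proof cases
    case 1
    then have "1 * z \<le> x * z" "y * z' \<le> 0"
      using z by (intro mult_right_mono mult_nonpos_nonneg; simp)+
    then show ?thesis
      using abs_eq by linarith
  next
    case 2
    then have "x * z \<le> (-1) * z" "0 \<le> y * z'"
      using z by (intro mult_right_mono mult_nonneg_nonneg; simp)+
    then show ?thesis
      using abs_eq by linarith
  next
    case 3
    then have "0 < y * q'" "y * q' < 1 * q'"
      using b bx by auto
    then show ?thesis
      using q by (auto simp: zero_less_mult_iff mult_less_cancel_right)
  next
    case 4
    then have "0 < x * q" "1 * q' \<le> y * q'"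
      using q by (intro mult_right_mono mult_pos_pos; simp)+
    then show ?thesis
      using b bx by linarith
  next
    case 5
    then have "x * q < 0" "y * q' < 0"
      using q by (simp_all add: mult_neg_pos)
    then show ?thesis
      using b bx by linarith
  qed
qed

text \<open>The congruences say that \<open>q\<close> obeys a continued fraction recurrence
  \<open>q (m + 2) = c m * q (m + 1) + q m\<close>.\<close>

lemma ex_unimodular_numerators:
  fixes q :: "nat \<Rightarrow> int"
  assumes "coprime (q 0) (q 1)" and cong: "\<And>m. [q (m + 2) = q m] (mod q (m + 1))"
  shows "\<exists>p. \<forall>m. p (Suc m) * q m - p m * q (Suc m) = (-1) ^ m"
proof -
  \<comment> \<open>Bezout coefficients supply the first two numerators \<open>- y\<close> and
    \<open>x\<close>, with determinant 1.\<close>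
  obtain x y where xy: "x * q 0 + y * q 1 = 1"
    using bezout_int[of "q 0" "q 1"] assms(1) by auto
  define c where "c m = (q (m + 2) - q m) div q (m + 1)" for m
  have c: "q (m + 2) = c m * q (m + 1) + q m" for m
    using cong[of m] unfolding c_def by (simp add: cong_iff_dvd_diff)
  \<comment> \<open>\<open>P m\<close> holds the numerators of index \<open>m\<close> and
    \<open>m + 1\<close>, which turns the two-term recurrence into a primitive recursion.\<close>
  define P where "P = rec_nat (- y, x) (\<lambda>m (a, b). (b, c m * b + a))"
  define p where "p m = fst (P m)" for m
  have P_Suc: "P (Suc m) = (snd (P m), c m * snd (P m) + fst (P m))" for m
    by (simp add: P_def split_beta)
  have p0: "p 0 = - y" "p 1 = x" and pS: "p (m + 2) = c m * p (m + 1) + p m" for m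
    by (simp_all add: p_def P_Suc) (simp_all add: P_def)
  have "p (Suc m) * q m - p m * q (Suc m) = (-1) ^ m" for m
  proof (induction m)
    case 0
    then show ?case
      using p0 xy by (simp add: algebra_simps)
  next
    case (Suc m)
    have "p (Suc (Suc m)) * q (Suc m) - p (Suc m) * q (Suc (Suc m))
        = - (p (Suc m) * q m - p m * q (Suc m))"
      using c[of m] pS[of m] by (simp add: algebra_simps)
    then show ?case
      using Suc by simp
  qed
  then show ?thesis
    by blast
qed

text \<open>The number is the limit of \<open>p m / q m\<close>, the partial sums of an alternating
  series, so these fractions lie on alternating sides of it. Hence \<open>z m\<close> is the
  unsigned error, the determinant gives the linear identity, and
  \<open>det_best_approximation\<close> gives the measure function.\<close>

lemma ex_real_with_denominators:
  fixes q :: "nat \<Rightarrow> nat"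
  assumes pos: "\<And>m. 0 < q m" and mono: "strict_mono q"
    and cop: "coprime (q 0) (q 1)" and cong: "\<And>m. [q (m + 2) = q m] (mod q (m + 1))"
  shows "\<exists>\<alpha> z. (\<forall>m. 0 \<le> z m) \<and> (\<forall>m. real (q (Suc m)) * z m + real (q m) * z (Suc m) = 1) \<and>
    (\<forall>m t. real (q m) \<le> t \<longrightarrow> t < real (q (Suc m)) \<longrightarrow> irr_meas \<alpha> t = z m)"
proof -
  obtain p where det: "\<And>m. p (Suc m) * int (q m) - p m * int (q (Suc m)) = (-1) ^ m"
    using ex_unimodular_numerators[of "\<lambda>m. int (q m)"] cop cong by (auto simp: cong_int_iff)
  have det_real: "real_of_int (p (Suc m)) * q m - p m * real (q (Suc m)) = (-1) ^ m" for m
    using arg_cong[OF det[of m], of real_of_int] by simp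
  define a where "a m = 1 / (real (q m) * real (q (Suc m)))" for m
  define x where "x m = p m / real (q m)" for m
  have x_Suc: "x (Suc m) = x m + (-1) ^ m * a m" for m
    using det_real[of m] pos[of m] pos[of "Suc m"]
    by (simp add: x_def a_def field_simps)
  have x_sum: "x m = x 0 + (\<Sum>i<m. (-1) ^ i * a i)" for m
    by (induction m) (simp_all add: x_Suc)
  have q_ge: "m \<le> q m" for m
    using mono strict_mono_imp_increasing by blast
  have a_nonneg: "0 \<le> a m" for m
    by (simp add: a_def)
  have a_dec: "a (Suc m) \<le> a m" for m
    unfolding a_def using pos mono strict_mono_less_eq[OF mono, of m "Suc (Suc m)"]
    by (intro divide_left_mono) (auto simp: mult.commute intro!: mult_left_mono)
  have a_lim: "a \<longlonglongrightarrow> 0"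
  proof (rule tendsto_sandwich[of "\<lambda>_. 0" _ _ "\<lambda>m. inverse (real (Suc m))"])
    have "a m \<le> inverse (real (Suc m))" for m
    proof -
      have "1 * Suc m \<le> q m * q (Suc m)"
        using pos[of m] q_ge[of "Suc m"] by (intro mult_le_mono) auto
      then have "real (Suc m) \<le> real (q m) * real (q (Suc m))"
        by (metis mult_1 of_nat_le_iff of_nat_mult)
      then show ?thesis
        unfolding a_def inverse_eq_divide using pos by (intro divide_left_mono) auto
    qed
    then show "\<forall>\<^sub>F m in sequentially. a m \<le> inverse (real (Suc m))"
      by simp
  qed (use a_nonneg LIMSEQ_inverse_real_of_nat in auto)
  define \<alpha> where "\<alpha> = x 0 + (\<Sum>i. (-1) ^ i * a i)"
  define z where "z m = (-1) ^ m * (q m * \<alpha> - p m)" for m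
  have z_nonneg: "0 \<le> z m" for m
  proof (cases "even m")
    case True
    then obtain l where l: "m = 2 * l" by blast
    have "x m \<le> \<alpha>"
      using summable_Leibniz'(2)[OF a_lim a_nonneg a_dec, of l] x_sum[of m]
      by (simp add: \<alpha>_def l)
    then show ?thesis
      using True pos[of m] by (simp add: z_def x_def field_simps)
  next
    case False
    then obtain l where l: "m = 2 * l + 1" using oddE by blast
    have "\<alpha> \<le> x m"
      using summable_Leibniz'(4)[OF a_lim a_nonneg a_dec, of l] x_sum[of m]
      by (simp add: \<alpha>_def l)
    then show ?thesis
      using False pos[of m] by (simp add: z_def x_def field_simps)
  qed
  have sgn: "(-1) ^ m * ((-1) ^ m :: real) = 1" for m
    by (simp flip: power_mult_distrib)
  have "real (q (Suc m)) * z m + real (q m) * z (Suc m) = 1" for m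
  proof -
    have "real (q (Suc m)) * z m + real (q m) * z (Suc m)
        = (-1) ^ m * (real_of_int (p (Suc m)) * q m - p m * real (q (Suc m)))"
      unfolding z_def by (simp add: algebra_simps)
    then show ?thesis
      using sgn by (simp only: det_real)
  qed
  moreover have "irr_meas \<alpha> t = z m" if t: "real (q m) \<le> t" "t < real (q (Suc m))" for m t
  proof -
    have z_eq: "q i * \<alpha> - p i = (-1) ^ i * z i" for i
      using sgn[of i] unfolding z_def by (simp flip: mult.assoc)
    have best: "z m \<le> \<bar>real b * \<alpha> - real_of_int c\<bar>" if "0 < b" "b < q (Suc m)" for b :: nat and c
      using det_best_approximation[of "p (Suc m)" "int (q m)" "p m" "int (q (Suc m))" "(-1) ^ m"
          "z m" "z (Suc m)" \<alpha> "int b" c]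
        det[of m] pos[of m] pos[of "Suc m"] z_nonneg z_eq[of m] z_eq[of "Suc m"] that
      by (auto simp: minus_one_power_iff)
    have best': "z m \<le> int_dist (real b * \<alpha>)" if "0 < b" "b < q (Suc m)" for b :: nat
      unfolding int_dist_eq_round using best that by blast
    \<comment> \<open>With the lower bound taken at \<open>b = q m\<close>, this shows that
      \<open>q m\<close> itself attains the minimum.\<close>
    have "int_dist (real (q m) * \<alpha>) \<le> \<bar>real (q m) * \<alpha> - p m\<bar>"
      unfolding int_dist_eq_round by (rule round_diff_minimal)
    also have "\<dots> = z m"
      using z_nonneg[of m] unfolding z_eq by (simp add: abs_mult)
    finally have attained: "z m = int_dist (real (q m) * \<alpha>)"
      using best'[of "q m"] pos[of m] t by linarith
    have "1 \<le> t"
      using t pos[of m] by linarith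
    show ?thesis
      unfolding irr_meas_def
    proof (rule Min_eqI)
      show "finite ((\<lambda>b::nat. int_dist (real b * \<alpha>)) ` {b. 1 \<le> b \<and> real b \<le> t})"
        using irr_meas_range(1)[OF \<open>1 \<le> t\<close>] by blast
      show "z m \<le> y" if "y \<in> (\<lambda>b::nat. int_dist (real b * \<alpha>)) ` {b. 1 \<le> b \<and> real b \<le> t}" for y
        using that best' t by force
      show "z m \<in> (\<lambda>b::nat. int_dist (real b * \<alpha>)) ` {b. 1 \<le> b \<and> real b \<le> t}"
        using attained pos[of m] t by (auto intro!: image_eqI[of _ _ "q m"] simp: Suc_le_eq)
    qed
  qed
  ultimately show ?thesis
    using z_nonneg by blast
qed

section \<open>Jumps along residue classes and the predicted order\<close>

text \<open>The least \<open>m > s\<close> with \<open>m mod k = i\<close>.\<close>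

definition next_residue :: "nat \<Rightarrow> nat \<Rightarrow> nat \<Rightarrow> nat" where
  "next_residue k i s = s + 1 + (i + (k - 1) * (s + 1)) mod k"

context
  fixes k i :: nat
  assumes i: "i < k"
begin

lemma next_residue_gt: "s < next_residue k i s"
  by (simp add: next_residue_def)

lemma next_residue_le: "next_residue k i s \<le> s + k"
  using i mod_less_divisor[of k "i + (k - 1) * (s + 1)"] unfolding next_residue_def by linarith

lemma next_residue_mod: "next_residue k i s mod k = i"
proof -
  obtain k' where k': "k = Suc k'"
    using i by (cases k) auto
  have "next_residue k i s mod k = (s + 1 + (i + (k - 1) * (s + 1))) mod k"
    unfolding next_residue_def by (simp only: mod_add_right_eq)
  \<comment> \<open>The term \<open>(k - 1) * (s + 1)\<close> stands for \<open>- (s + 1)\<close>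
    modulo \<open>k\<close> without subtraction of naturals.\<close>
  also have "s + 1 + (i + (k - 1) * (s + 1)) = i + k * (s + 1)"
    by (simp add: k')
  finally show ?thesis
    using i by (simp only: mod_mult_self2 mod_less)
qed

lemma next_residue_unique:
  assumes "s < m" "m \<le> s + k" "m mod k = i"
  shows "next_residue k i s = m"
proof (rule ccontr)
  have *: False if "a < b" "a mod k = b mod k" "b < a + k" for a b
    using that by (metis (no_types) add_diff_cancel_left' le_add_diff_inverse less_imp_le_nat
        mod_eq_dvd_iff_nat nat_add_left_cancel_less nat_dvd_not_less zero_less_diff)
  assume "next_residue k i s \<noteq> m"
  then show False
    using *[of m "next_residue k i s"] *[of "next_residue k i s" m]
      next_residue_gt[of s] next_residue_le[of s] next_residue_mod[of s] assms
    by (cases "m < next_residue k i s") auto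
qed

lemma next_residue_shift: "next_residue k i (s + k) = next_residue k i s + k"
  using next_residue_gt[of s] next_residue_le[of s] next_residue_mod[of s]
  by (intro next_residue_unique) auto

lemma next_residue_self: "a mod k = i \<Longrightarrow> next_residue k i a = a + k"
  using i by (intro next_residue_unique) auto

lemma next_residue_between:
  "a \<le> s \<Longrightarrow> s < next_residue k i a \<Longrightarrow> next_residue k i s = next_residue k i a"
  using next_residue_le[of a] next_residue_mod[of a] by (intro next_residue_unique) auto

end

text \<open>For the number attached to the residues \<open>i\<close> and \<open>j\<close>, this is
  the index of its first denominator after \<open>T s\<close>; \<open>i = j\<close> is
  allowed.\<close>

definition next_jump :: "nat \<Rightarrow> nat \<Rightarrow> nat \<Rightarrow> nat \<Rightarrow> nat" where
  "next_jump k i j s = min (next_residue k i s) (next_residue k j s)"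

lemma next_jump_commute: "next_jump k i j = next_jump k j i"
  by (simp add: next_jump_def fun_eq_iff min.commute)

context
  fixes k i j :: nat
  assumes i: "i < k" and j: "j < k"
begin

lemma next_jump_gt: "s < next_jump k i j s"
  using i j by (simp add: next_jump_def next_residue_gt)

lemma next_jump_mod: "next_jump k i j s mod k \<in> {i, j}"
  using i j by (simp add: next_jump_def min_def next_residue_mod)

lemma next_jump_le: "next_jump k i j s \<le> s + k"
  using next_residue_le[OF i, of s] by (simp add: next_jump_def min.coboundedI1)

lemma next_jump_shift: "next_jump k i j (s + k) = next_jump k i j s + k"
  using i j by (simp add: next_jump_def next_residue_shift min_add_distrib_left)

lemma next_jump_between:
  "a \<le> s \<Longrightarrow> s < next_jump k i j a \<Longrightarrow> next_jump k i j s = next_jump k i j a"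
  using i j by (simp add: next_jump_def next_residue_between)

lemma next_jump_lt:
  assumes "i \<noteq> j" "s mod k = i"
  shows "next_jump k i j s < s + k"
proof -
  have "next_residue k j s \<noteq> s + k"
    using assms next_residue_mod[OF j, of s] by auto
  then show ?thesis
    using next_residue_le[OF j, of s] by (simp add: next_jump_def min.strict_coboundedI2)
qed

text \<open>The other residue occurs before \<open>a + k\<close>, so the first jump goes there and
  the second returns. This yields the triple of indices in \<open>T_cong_between\<close>.\<close>

lemma next_jump_twice:
  assumes "i \<noteq> j" "a mod k = i"
  shows "next_jump k i j (next_jump k i j a) = a + k"
proof -
  have "next_residue k i a = a + k"
    using next_residue_self[OF i] assms by blast
  with next_jump_lt[OF assms] have b: "next_jump k i j a = next_residue k j a"
    by (auto simp: next_jump_def)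
  have "next_residue k i (next_jump k i j a) = a + k"
    using next_residue_between[OF i] next_jump_gt next_jump_lt[OF assms]
      \<open>next_residue k i a = a + k\<close> by (metis less_imp_le)
  moreover have "next_residue k j (next_jump k i j a) = next_jump k i j a + k"
    using next_residue_self[OF j] next_residue_mod[OF j] b by metis
  ultimately show ?thesis
    using next_jump_gt[of a] by (simp add: next_jump_def[of k i j "next_jump k i j a"])
qed

end

text \<open>Two consecutive denominators thus identify the number. For \<open>i \<noteq> j\<close> a
  jump cannot end in the residue it started from: that would take \<open>k\<close> steps, and the
  other residue comes sooner.\<close>

lemma next_jump_residues:
  assumes "i < k" "j < k"
  shows "{next_jump k i j s mod k, next_jump k i j (next_jump k i j s) mod k} = {i, j}"
proof (cases "i = j")
  case True
  then show ?thesis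
    using next_jump_mod[of i k j] assms by auto
next
  case False
  define a where "a = next_jump k i j s"
  have "next_jump k i j a mod k \<noteq> a mod k"
  proof
    assume eq: "next_jump k i j a mod k = a mod k"
    have mod: "a mod k \<in> {i, j}"
      unfolding a_def using next_jump_mod assms by blast
    then have "next_jump k i j a < a + k"
      using next_jump_lt[of i k j a] next_jump_lt[of j k i a] assms False
      by (auto simp: next_jump_commute)
    moreover have "next_residue k (a mod k) a = next_jump k i j a"
      using next_jump_gt next_jump_le assms eq
      by (intro next_residue_unique) auto
    moreover have "next_residue k (a mod k) a = a + k"
      using assms by (intro next_residue_self) auto
    ultimately show False
      by simp
  qed
  then show ?thesis
    using next_jump_mod[of i k j s] next_jump_mod[of i k j a] assms
    unfolding a_def[symmetric] by auto
qed

text \<open>The predicted order on block \<open>s\<close>: the first number has the larger measure function.\<close>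

definition jumps_above :: "nat \<Rightarrow> nat \<Rightarrow> nat \<times> nat \<Rightarrow> nat \<times> nat \<Rightarrow> bool" where
  "jumps_above k s = (\<lambda>(i, j) (i', j').
     let a = next_jump k i j s; b = next_jump k i' j' s
     in a < b \<or> a = b \<and> next_jump k i' j' b < next_jump k i j a)"

text \<open>If neither holds, both jumps agree, hence so do the residue sets, and
  \<open>i \<le> j\<close> recovers the pair from its set.\<close>

lemma jumps_above_total:
  assumes "i \<le> j" "j < k" "i' \<le> j'" "j' < k" "(i, j) \<noteq> (i', j')"
  shows "jumps_above k s (i, j) (i', j') \<or> jumps_above k s (i', j') (i, j)"
proof (rule ccontr)
  assume "\<not> ?thesis"
  then have "next_jump k i j s = next_jump k i' j' s"
    "next_jump k i j (next_jump k i j s) = next_jump k i' j' (next_jump k i' j' s)"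
    unfolding jumps_above_def Let_def by auto
  then have "{i, j} = {i', j'}"
    using next_jump_residues[of i k j s] next_jump_residues[of i' k j' s] assms by simp
  then show False
    using assms by (auto simp: doubleton_eq_iff)
qed

text \<open>Translating the block by \<open>k\<close> translates every jump by \<open>k\<close> and
  preserves all comparisons.\<close>

lemma jumps_above_mod:
  assumes "i < k" "j < k" "i' < k" "j' < k"
  shows "jumps_above k s (i, j) (i', j') = jumps_above k (s mod k) (i, j) (i', j')"
proof -
  have "jumps_above k (r + m * k) (i, j) (i', j') = jumps_above k r (i, j) (i', j')" for r m
  proof (induction m)
    case (Suc m)
    have "r + Suc m * k = r + m * k + k"
      by simp
    then show ?case
      using Suc assms by (simp only:) (simp add: jumps_above_def next_jump_shift Let_def)
  qed simp
  from this[of "s mod k" "s div k"] show ?thesis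
    by simp
qed

text \<open>Diagonal pairs tell the blocks apart: with \<open>x\<close> the residue of
  \<open>r + 1\<close>, the pair \<open>(x, x)\<close> jumps right after block \<open>r\<close>, and
  any other diagonal pair jumps later.\<close>

lemma jumps_above_distinguishes:
  assumes "r < k" "r' < k" "r \<noteq> r'"
  shows "\<exists>x<k. \<exists>y<k. jumps_above k r (x, x) (y, y) \<and> jumps_above k r' (y, y) (x, x)"
proof -
  define x where "x = Suc r mod k"
  define y where "y = Suc r' mod k"
  have xy: "x < k" "y < k"
    using assms by (auto simp: x_def y_def)
  have "x \<noteq> y"
    using assms by (auto simp: x_def y_def mod_Suc split: if_splits)
  have nx: "next_residue k x r = Suc r" "next_residue k y r' = Suc r'"
    using assms xy by (auto intro!: next_residue_unique simp: x_def y_def)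
  have "next_residue k y r \<noteq> Suc r" "next_residue k x r' \<noteq> Suc r'"
    using next_residue_mod[OF xy(2), of r] next_residue_mod[OF xy(1), of r'] \<open>x \<noteq> y\<close>
    by (auto simp: x_def y_def)
  then have "Suc r < next_residue k y r" "Suc r' < next_residue k x r'"
    using next_residue_gt[OF xy(2), of r] next_residue_gt[OF xy(1), of r'] by linarith+
  then show ?thesis
    using xy nx by (intro exI[of _ x] exI[of _ y]) (auto simp: jumps_above_def next_jump_def)
qed

section \<open>From jumps to values of the measure function\<close>

context jump_times
begin

lemma T_less_Suc: "2 * T m < T (Suc m)"
  using T_growth[of m] T_pos[of m] self_le_power[of "T m" 2] by linarith

lemma T_strict_mono: "strict_mono T"
  unfolding strict_mono_Suc_iff using T_less_Suc by (metis add_lessD1 mult_2)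

lemma T_mono: "l \<le> m \<Longrightarrow> T l \<le> T m"
  using T_strict_mono by (simp add: strict_mono_less_eq)

lemma T_growth_less: "l < m \<Longrightarrow> 2 * (T l)\<^sup>2 < T m"
  using T_growth[of l] T_mono[of "Suc l" m] by linarith

lemma T_less: "l < m \<Longrightarrow> 2 * T l < T m"
  using T_less_Suc[of l] T_mono[of "Suc l" m] by linarith

text \<open>\<open>z\<close> and \<open>z'\<close> are the values of the measure function on the current and the next step,
  \<open>T a\<close> is the current denominator.\<close>

definition has_jumps :: "real \<Rightarrow> nat \<Rightarrow> nat \<Rightarrow> bool" where
  "has_jumps \<alpha> i j \<longleftrightarrow> (\<forall>s\<ge>k. \<exists>a (z::real) z'::real. a \<le> s \<and> 0 \<le> z' \<and>
     (\<forall>t. real (T s) \<le> t \<longrightarrow> t < real (T (Suc s)) \<longrightarrow> irr_meas \<alpha> t = z) \<and>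
     (let b = next_jump k i j s; c = next_jump k i j b in
        real (T b) * z + real (T a) * z' = 1 \<and> 1 / 2 \<le> T b * z \<and> T b * z \<le> 1 \<and>
        1 / 2 \<le> T c * z' \<and> T c * z' \<le> 1))"

text \<open>Iterating \<open>next_jump\<close> from \<open>i\<close> lists the indices
  \<open>u\<close> of the denominators; the two congruences of the locale cover \<open>i = j\<close>
  and \<open>i \<noteq> j\<close>.\<close>

lemma ex_has_jumps:
  assumes i: "i < k" and j: "j < k"
  shows "\<exists>\<alpha>. has_jumps \<alpha> i j"
proof -
  define u where "u m = (next_jump k i j ^^ m) i" for m
  have u_Suc: "u (Suc m) = next_jump k i j (u m)" for m
    by (simp add: u_def)
  have u_less: "u m < u (Suc m)" for m
    using next_jump_gt i j by (simp add: u_Suc)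
  have u_mod: "u m mod k \<in> {i, j}" for m
    using next_jump_mod[OF i j] i by (cases m) (auto simp: u_def)
  have u_le: "u (Suc m) \<le> u m + k" for m
    using next_jump_le[OF i j] by (simp add: u_Suc)
  define q where "q m = T (u m)" for m
  have q_less: "2 * q m < q (Suc m)" for m
    using T_less u_less by (simp add: q_def)
  have q_pos: "0 < q m" for m
    using T_pos by (simp add: q_def)
  have "strict_mono q"
    unfolding strict_mono_Suc_iff using q_less by (metis add_lessD1 mult_2)
  moreover have "coprime (q 0) (q 1)"
    using T_coprime u_less[of 0] u_le[of 0] by (simp add: q_def)
  moreover have "[q (m + 2) = q m] (mod q (m + 1))" for m
  proof (cases "i = j")
    case True
    then have "next_residue k i (u m) = u m + k" for m
      using next_residue_self[OF i] u_mod[of m] by auto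
    then have "u (Suc m) = u m + k" for m
      using True by (simp add: u_Suc next_jump_def)
    then have "u (m + 1) = u m + k" "u (m + 2) = u m + 2 * k"
      by simp_all
    then show ?thesis
      using T_cong_twice by (simp only: q_def)
  next
    case False
    have "u (m + 1) < u m + k" "u (m + 2) = u m + k"
      using u_mod[of m] next_jump_lt[OF i j False, of "u m"] next_jump_lt[OF j i, of "u m"]
        next_jump_twice[OF i j False, of "u m"] next_jump_twice[OF j i, of "u m"] False
      by (auto simp: u_Suc next_jump_commute[of k j i])
    then show ?thesis
      using T_cong_between[of "u m" "u (m + 1)"] u_less[of m] by (simp add: q_def)
  qed
  ultimately obtain \<alpha> z where z_nonneg: "\<And>m. 0 \<le> z m"
    and z_sum: "\<And>m. real (q (Suc m)) * z m + real (q m) * z (Suc m) = 1"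
    and meas: "\<And>m t. real (q m) \<le> t \<Longrightarrow> t < real (q (Suc m)) \<Longrightarrow> irr_meas \<alpha> t = z m"
    using ex_real_with_denominators[of q] q_pos by blast
  have z_le: "q (Suc m) * z m \<le> 1" for m
    using z_sum[of m] z_nonneg[of "Suc m"] mult_nonneg_nonneg[of "real (q m)" "z (Suc m)"]
    by linarith
  \<comment> \<open>Of the two terms with sum 1 the second is at most 1/2, since \<open>q m\<close>
    is at most half of \<open>q (m + 2)\<close>.\<close>
  have z_ge: "1 / 2 \<le> q (Suc m) * z m" for m
  proof -
    have "2 * q m \<le> q (Suc (Suc m))"
      using q_less[of m] q_less[of "Suc m"] by linarith
    then have "2 * real (q m) * z (Suc m) \<le> q (Suc (Suc m)) * z (Suc m)"
      using z_nonneg by (intro mult_right_mono) linarith+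
    then show ?thesis
      using z_le[of "Suc m"] z_sum[of m] by linarith
  qed
  have "has_jumps \<alpha> i j"
    unfolding has_jumps_def
  proof (intro allI impI)
    \<comment> \<open>As \<open>u\<close> starts at \<open>i < k\<close>, some denominator has been
      reached from block \<open>k\<close> on.\<close>
    fix s assume "k \<le> s"
    then have "i \<le> s"
      using i by simp
    then have "\<exists>m. u m \<le> s \<and> s < u (Suc m)"
    proof (induction s rule: dec_induct)
      case base
      then show ?case
        using u_less[of 0] by (intro exI[of _ 0]) (simp add: u_def)
    next
      case (step s)
      then obtain m where "u m \<le> s" "s < u (Suc m)"
        by blast
      then show ?case
        using u_less[of "Suc m"] by (cases "Suc s < u (Suc m)") (auto intro: exI[of _ m] exI[of _ "Suc m"])
    qed
    then obtain m where m: "u m \<le> s" "s < u (Suc m)"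
      by blast
    then have "next_jump k i j s = u (Suc m)"
      using next_jump_between[OF i j] by (simp add: u_Suc)
    moreover have "irr_meas \<alpha> t = z m" if "real (T s) \<le> t" "t < real (T (Suc s))" for t
    proof (rule meas)
      have "q m \<le> T s" "T (Suc s) \<le> q (Suc m)"
        unfolding q_def using m by (auto intro: T_mono)
      then show "real (q m) \<le> t" "t < real (q (Suc m))"
        using that by linarith+
    qed
    ultimately show "\<exists>a (z::real) z'::real. a \<le> s \<and> 0 \<le> z' \<and>
     (\<forall>t. real (T s) \<le> t \<longrightarrow> t < real (T (Suc s)) \<longrightarrow> irr_meas \<alpha> t = z) \<and>
     (let b = next_jump k i j s; c = next_jump k i j b in
        real (T b) * z + real (T a) * z' = 1 \<and> 1 / 2 \<le> T b * z \<and> T b * z \<le> 1 \<and>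
        1 / 2 \<le> T c * z' \<and> T c * z' \<le> 1)"
      using m(1) z_nonneg z_sum[of m] z_le[of m] z_le[of "Suc m"] z_ge[of m] z_ge[of "Suc m"]
      by (intro exI[of _ "u m"] exI[of _ "z m"] exI[of _ "z (Suc m)"])
        (simp add: q_def u_Suc Let_def)
  qed
  then show ?thesis
    by blast
qed

text \<open>If the next denominators differ, their ratio exceeds the factor 2 by which
  \<open>T b * z\<close> is uncertain. If they agree, the identity with sum 1 reduces the claim to
  \<open>T a * w < T a' * w'\<close>: a later second jump subtracts less.\<close>

lemma jumps_above_imp_irr_meas_less:
  assumes "has_jumps \<alpha> i j" "has_jumps \<beta> i' j'"
    and e: "i < k" "j < k" "i' < k" "j' < k"
    and s: "k \<le> s" and t: "real (T s) \<le> t" "t < real (T (Suc s))"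
    and above: "jumps_above k s (i, j) (i', j')"
  shows "irr_meas \<beta> t < irr_meas \<alpha> t"
proof -
  define b where "b = next_jump k i j s"
  define c where "c = next_jump k i j b"
  define b' where "b' = next_jump k i' j' s"
  define c' where "c' = next_jump k i' j' b'"
  obtain a and z w :: real where a: "a \<le> s" and w: "0 \<le> w"
    and meas: "\<forall>t. real (T s) \<le> t \<longrightarrow> t < real (T (Suc s)) \<longrightarrow> irr_meas \<alpha> t = z"
    and sum: "T b * z + T a * w = 1" "1 / 2 \<le> T b * z" "T c * w \<le> 1"
    using assms(1)[unfolded has_jumps_def Let_def, THEN spec, THEN mp, OF s, folded b_def, folded c_def]
    by (elim exE conjE) (rule that)
  obtain a' and z' w' :: real where w': "0 \<le> w'"
    and meas': "\<forall>t. real (T s) \<le> t \<longrightarrow> t < real (T (Suc s)) \<longrightarrow> irr_meas \<beta> t = z'"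
    and sum': "T b' * z' + T a' * w' = 1" "T b' * z' \<le> 1" "1 / 2 \<le> T c' * w'"
    using assms(2)[unfolded has_jumps_def Let_def, THEN spec, THEN mp, OF s, folded b'_def, folded c'_def]
    by (elim exE conjE) (rule that)
  have z: "irr_meas \<alpha> t = z" and z': "irr_meas \<beta> t = z'"
    using meas meas' t by blast+
  have less: "s < b" "b < c" "s < b'" "b' < c'"
    unfolding b_def c_def b'_def c'_def using next_jump_gt e by blast+
  have Tpos: "0 < real (T m)" for m
    using T_pos by simp
  from above consider "b < b'" | "b = b'" "c' < c"
    unfolding jumps_above_def Let_def b_def c_def b'_def c'_def by auto
  then have "z' < z"
  proof cases
    case 1
    have "z' \<le> 1 / T b'"
      using sum'(2) Tpos[of b'] by (simp add: field_simps)
    also have "\<dots> < 1 / (2 * T b)"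
      using T_less[OF 1] Tpos[of b] Tpos[of b'] by (intro divide_strict_left_mono) auto
    also have "\<dots> \<le> z"
      using sum(2) Tpos[of b] by (simp add: field_simps)
    finally show ?thesis .
  next
    case 2
    \<comment> \<open>The factor \<open>T a\<close> is only bounded by \<open>T c'\<close>, so
      \<open>T c\<close> has to exceed the square of \<open>T c'\<close>.\<close>
    have "2 * (real (T c') * real (T a)) \<le> 2 * (real (T c'))\<^sup>2"
      using T_mono[of a c'] a less unfolding power2_eq_square
      by (intro mult_left_mono) auto
    also have "\<dots> < T c"
      using T_growth_less[OF 2(2)] by (metis of_nat_less_iff of_nat_mult of_nat_numeral of_nat_power)
    finally have cc: "2 * (real (T c') * real (T a)) < T c" .
    have "T a * w \<le> T a * (1 / T c)"
      using sum(3) Tpos[of c] by (intro mult_left_mono) (auto simp: field_simps)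
    also have "\<dots> < 1 / (2 * T c')"
      using cc Tpos[of c] Tpos[of c'] by (simp add: field_simps)
    also have "\<dots> \<le> w'"
      using sum'(3) Tpos[of c'] by (simp add: field_simps)
    also have "1 * w' \<le> T a' * w'"
      using w' T_pos[of a'] by (intro mult_right_mono) auto
    finally have "T b * z' < T b * z"
      using sum(1) sum'(1) 2 by simp
    then show ?thesis
      using Tpos by (simp add: mult_less_cancel_left_pos)
  qed
  then show ?thesis
    by (simp add: z z')
qed

lemma ex_time_block:
  assumes "real (T k) \<le> t"
  shows "\<exists>s\<ge>k. real (T s) \<le> t \<and> t < real (T (Suc s))"
proof -
  have T_ge: "m \<le> T m" for m
    using T_strict_mono strict_mono_imp_increasing by blast
  obtain N where "t < real N"
    using reals_Archimedean2 by blast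
  then have ex: "t < real (T N)"
    using T_ge[of N] by linarith
  define m where "m = (LEAST m. t < real (T m))"
  have m: "t < real (T m)"
    unfolding m_def using ex by (rule LeastI)
  have "k < m"
    using m assms T_mono[of m k] by (cases "k < m") auto
  then obtain s where s: "m = Suc s" "k \<le> s"
    by (cases m) auto
  then have "\<not> t < real (T s)"
    using not_less_Least[of s "\<lambda>m. t < real (T m)"] by (simp add: m_def)
  then show ?thesis
    using s m by auto
qed

end

section \<open>Order permutations and a count of pairs\<close>

text \<open>\<open>inv \<sigma> i\<close> is the position of \<open>i\<close> in the decreasing
  order, so the permutation determines every comparison.\<close>

lemma orders_at_less_iff:
  assumes "orders_at n \<alpha> t \<sigma>" "i \<in> {1..n}" "j \<in> {1..n}"
  shows "irr_meas (\<alpha> j) t < irr_meas (\<alpha> i) t \<longleftrightarrow> inv \<sigma> i < inv \<sigma> j"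
proof -
  have p: "\<sigma> permutes {1..n}"
    and d: "\<And>i j. i \<in> {1..n} \<Longrightarrow> j \<in> {1..n} \<Longrightarrow> i < j \<Longrightarrow> irr_meas (\<alpha> (\<sigma> j)) t < irr_meas (\<alpha> (\<sigma> i)) t"
    using assms(1) unfolding orders_at_def by blast+
  have "inv \<sigma> i \<in> {1..n}" "inv \<sigma> j \<in> {1..n}"
    using permutes_in_image[OF permutes_inv[OF p]] assms(2,3) by blast+
  moreover have "\<sigma> (inv \<sigma> i) = i" "\<sigma> (inv \<sigma> j) = j"
    using permutes_inverses(1)[OF p] by simp_all
  ultimately show ?thesis
    using d by (metis less_asym less_irrefl nat_neq_iff)
qed

text \<open>\<open>orders_at\<close> sees the values only through strict comparisons, so both
  descriptions have the same predicate.\<close>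

lemma order_perm_cong:
  assumes "\<And>i j. i \<in> {1..n} \<Longrightarrow> j \<in> {1..n} \<Longrightarrow>
    irr_meas (\<alpha> j) t < irr_meas (\<alpha> i) t \<longleftrightarrow> irr_meas (\<alpha> j) t' < irr_meas (\<alpha> i) t'"
  shows "order_perm n \<alpha> t = order_perm n \<alpha> t'"
proof -
  have "orders_at n \<alpha> t \<sigma> = orders_at n \<alpha> t' \<sigma>" for \<sigma>
    unfolding orders_at_def
    by (intro conj_cong refl ball_cong imp_cong assms) (simp_all add: permutes_in_image del: atLeastAtMost_iff)
  then show ?thesis
    unfolding order_perm_def by presburger
qed

lemma card_ordered_pairs: "card {(i, j). i \<le> j \<and> j < k} = k * (k + 1) div (2 :: nat)"
proof -
  have "{(i, j). i \<le> j \<and> j < k} = (\<lambda>(j, i). (i, j)) ` (SIGMA j:{..<k}. {..j})"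
    by auto
  then have "card {(i, j). i \<le> j \<and> j < k} = card (SIGMA j:{..<k}. {..j})"
    by (simp add: card_image inj_on_def)
  also have "\<dots> = (\<Sum>j<k. Suc j)"
    by simp
  also have "\<dots> = k * (k + 1) div 2"
    by (induction k) auto
  finally show ?thesis .
qed

section \<open>The tuple and its permutations\<close>

theorem mainTheorem2:
  fixes k n :: nat
  assumes "k \<ge> 3" and "n = k * (k + 1) div 2"
  shows "\<exists>\<alpha> :: nat \<Rightarrow> real. pairwise_incommensurable n \<alpha> \<and> k_index n \<alpha> = k"
proof -
  have "0 < k"
    using assms by simp
  then obtain T where "jump_times k T"
    using ex_jump_times by blast
  then interpret jump_times k T .
  define E where "E = {(i, j). i \<le> j \<and> j < k}"
  have "E \<subseteq> {..<k} \<times> {..<k}"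
    by (auto simp: E_def)
  then have "finite E"
    using finite_subset by blast
  moreover have "card E = n"
    unfolding E_def assms(2) by (rule card_ordered_pairs)
  ultimately obtain h where h: "bij_betw h {1..n} E"
    using ex_bij_betw_nat_finite_1 by blast
  define \<alpha> where "\<alpha> x = (SOME \<alpha>. has_jumps \<alpha> (fst (h x)) (snd (h x)))" for x
  have h_E: "fst (h x) < k" "snd (h x) < k" "fst (h x) \<le> snd (h x)" if "x \<in> {1..n}" for x
  proof -
    have "h x \<in> E"
      using h that bij_betwE by blast
    then show "fst (h x) < k" "snd (h x) < k" "fst (h x) \<le> snd (h x)"
      by (auto simp: E_def)
  qed
  have \<alpha>: "has_jumps (\<alpha> x) (fst (h x)) (snd (h x))" if "x \<in> {1..n}" for x
    unfolding \<alpha>_def by (rule someI_ex[OF ex_has_jumps]) (use h_E[OF that] in blast)+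
  have h_inj: "h x \<noteq> h y" if "x \<in> {1..n}" "y \<in> {1..n}" "x \<noteq> y" for x y
    using h that unfolding bij_betw_def inj_on_def by blast
  have less: "irr_meas (\<alpha> y) t < irr_meas (\<alpha> x) t"
    if "x \<in> {1..n}" "y \<in> {1..n}" "k \<le> s" "real (T s) \<le> t" "t < real (T (Suc s))"
      "jumps_above k s (h x) (h y)" for x y s t
    by (rule jumps_above_imp_irr_meas_less[OF \<alpha> \<alpha>])
      (use that h_E in \<open>simp_all only: prod.collapse\<close>)
  have total: "jumps_above k s (h x) (h y) \<or> jumps_above k s (h y) (h x)"
    if "x \<in> {1..n}" "y \<in> {1..n}" "x \<noteq> y" for x y s
    using jumps_above_total[of "fst (h x)" "snd (h x)" k "fst (h y)" "snd (h y)" s]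
      h_E[OF that(1)] h_E[OF that(2)] h_inj[OF that] unfolding prod.collapse by blast
  \<comment> \<open>The right side sees the block only through \<open>s mod k\<close>, so at most
    \<open>k\<close> orders occur from \<open>T k\<close> on.\<close>
  have iff: "irr_meas (\<alpha> y) t < irr_meas (\<alpha> x) t \<longleftrightarrow> x \<noteq> y \<and> jumps_above k (s mod k) (h x) (h y)"
    if xy: "x \<in> {1..n}" "y \<in> {1..n}" and st: "k \<le> s" "real (T s) \<le> t" "t < real (T (Suc s))"
    for x y s t
  proof (cases "x = y")
    case False
    have "jumps_above k s (h x) (h y) = jumps_above k (s mod k) (h x) (h y)"
      using jumps_above_mod[of "fst (h x)" k "snd (h x)" "fst (h y)" "snd (h y)" s]
        h_E[OF xy(1)] h_E[OF xy(2)] unfolding prod.collapse by blast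
    then show ?thesis
      using False less[OF xy st] less[OF xy(2,1) st] total[OF xy False, of s]
        less_asym[of "irr_meas (\<alpha> y) t" "irr_meas (\<alpha> x) t"] by blast
  qed simp
  have distinct: "irr_meas (\<alpha> x) t \<noteq> irr_meas (\<alpha> y) t"
    if xy: "x \<in> {1..n}" "y \<in> {1..n}" "x \<noteq> y" and t: "real (T k) \<le> t" for x y t
  proof -
    obtain s where s: "k \<le> s" "real (T s) \<le> t" "t < real (T (Suc s))"
      using ex_time_block[OF t] by blast
    show ?thesis
      using total[OF xy, of s] less[OF xy(1,2) s] less[OF xy(2,1) s] by auto
  qed
  have incomm: "pairwise_incommensurable n \<alpha>"
    unfolding pairwise_incommensurable_def incommensurable_def eventually_at_top_linorder
    using distinct by blast
  have orders: "orders_at n \<alpha> t (order_perm n \<alpha> t)" if "real (T k) \<le> t" for t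
    unfolding order_perm_def
    by (rule theI'[OF orders_at_ex1]) (use distinct that in \<open>unfold inj_on_def, blast\<close>)
  \<comment> \<open>For \<open>r < k\<close> the block \<open>k + r\<close> has residue
    \<open>r\<close> and is late enough for the predicted order to hold.\<close>
  define G where "G r = order_perm n \<alpha> (T (k + r))" for r
  have T_in: "real (T s) < real (T (Suc s))" for s
    using T_strict_mono by (simp add: strict_mono_less)
  have G: "order_perm n \<alpha> t = G (s mod k)" if "k \<le> s" "real (T s) \<le> t" "t < real (T (Suc s))" for s t
    unfolding G_def
  proof (rule order_perm_cong)
    fix x y assume xy: "x \<in> {1..n}" "y \<in> {1..n}"
    show "irr_meas (\<alpha> y) t < irr_meas (\<alpha> x) t \<longleftrightarrow>
      irr_meas (\<alpha> y) (T (k + s mod k)) < irr_meas (\<alpha> x) (T (k + s mod k))"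
      using iff[OF xy that] iff[OF xy, of "k + s mod k" "T (k + s mod k)"] T_in by simp
  qed
  have occ: "{\<sigma>. \<sigma> permutes {1..n} \<and> occurs_arbitrarily_late n \<alpha> \<sigma>} = G ` {..<k}"
  proof (intro equalityI subsetI)
    fix \<sigma> assume "\<sigma> \<in> {\<sigma>. \<sigma> permutes {1..n} \<and> occurs_arbitrarily_late n \<alpha> \<sigma>}"
    then have "\<forall>t0>0. \<exists>t>t0. order_perm n \<alpha> t = \<sigma>"
      unfolding occurs_arbitrarily_late_def by blast
    moreover have "0 < real (T k)"
      using T_pos by simp
    ultimately obtain t where t: "real (T k) < t" "order_perm n \<alpha> t = \<sigma>"
      by blast
    then obtain s where "k \<le> s" "real (T s) \<le> t" "t < real (T (Suc s))"
      using ex_time_block[of t] by auto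
    then show "\<sigma> \<in> G ` {..<k}"
      using G t \<open>0 < k\<close> by auto
  next
    fix \<sigma> assume "\<sigma> \<in> G ` {..<k}"
    then obtain r where r: "r < k" "\<sigma> = G r"
      by blast
    have "\<sigma> permutes {1..n}"
      using orders[of "T (k + r)"] T_mono[of k "k + r"] r by (auto simp: G_def orders_at_def)
    moreover have "\<exists>t>t0. order_perm n \<alpha> t = \<sigma>" for t0 :: real
    proof -
      obtain N where N: "t0 < real N"
        using reals_Archimedean2 by blast
      \<comment> \<open>The summand \<open>r\<close> fixes the residue; \<open>Suc N\<close> periods
        ensure both \<open>k \<le> s\<close> and \<open>N \<le> s\<close>.\<close>
      define s where "s = r + Suc N * k"
      have "N \<le> N * k"
        using \<open>0 < k\<close> by simp
      then have "N \<le> s"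
        unfolding s_def mult_Suc by linarith
      also have "s \<le> T s"
        using T_strict_mono strict_mono_imp_increasing by blast
      finally have "t0 < real (T s)"
        using N by linarith
      moreover have "order_perm n \<alpha> (T s) = \<sigma>"
      proof -
        have "s mod k = r" "k \<le> s"
          using r unfolding s_def by (simp_all only: mod_mult_self1 mod_less) simp
        then show ?thesis
          using G[of s "T s"] T_in[of s] r by simp
      qed
      ultimately show ?thesis
        by blast
    qed
    ultimately show "\<sigma> \<in> {\<sigma>. \<sigma> permutes {1..n} \<and> occurs_arbitrarily_late n \<alpha> \<sigma>}"
      by (simp add: occurs_arbitrarily_late_def)
  qed
  have "inj_on G {..<k}"
  proof (rule inj_onI, rule ccontr)
    fix r r' assume r: "r \<in> {..<k}" "r' \<in> {..<k}" "G r = G r'" "r \<noteq> r'"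
    then obtain x y where xy: "x < k" "y < k" "jumps_above k r (x, x) (y, y)" "jumps_above k r' (y, y) (x, x)"
      using jumps_above_distinguishes[of r k r'] by auto
    then have "(x, x) \<in> h ` {1..n}" "(y, y) \<in> h ` {1..n}"
      using h by (auto simp: bij_betw_def E_def)
    then obtain v w where vw: "v \<in> {1..n}" "w \<in> {1..n}" "h v = (x, x)" "h w = (y, y)"
      by (metis imageE)
    \<comment> \<open>One permutation would order both times, although \<open>v\<close> and
      \<open>w\<close> compare oppositely at them.\<close>
    have ord: "orders_at n \<alpha> (T (k + r)) (G r)" "orders_at n \<alpha> (T (k + r')) (G r)"
      using orders[of "T (k + r)"] orders[of "T (k + r')"] T_mono r(3) by (auto simp: G_def)
    have "irr_meas (\<alpha> w) (T (k + r)) < irr_meas (\<alpha> v) (T (k + r))"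
      using less[OF vw(1,2), of "k + r"] T_in[of "k + r"] vw xy r
        jumps_above_mod[of x k x y y "k + r"] by simp
    moreover have "irr_meas (\<alpha> v) (T (k + r')) < irr_meas (\<alpha> w) (T (k + r'))"
      using less[OF vw(2,1), of "k + r'"] T_in[of "k + r'"] vw xy r
        jumps_above_mod[of y k y x x "k + r'"] by simp
    ultimately show False
      using orders_at_less_iff[OF ord(1) vw(1,2)] orders_at_less_iff[OF ord(2) vw(2,1)] by simp
  qed
  then have "k_index n \<alpha> = k"
    unfolding k_index_eq_card occ by (simp add: card_image)
  with incomm show ?thesis
    by blast
qed

end
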